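(* Let $n$ be a positive integer and let $Z$ be a nontrivial $1$-cycle over $\mathbb{F}_2$ on the vertex set $[n]$, i.e. a nonempty set of edges (2-element subsets of $[n]$) in which every vertex of $[n]$ has even degree. Then $Z$ is the boundary of a $2$-hypertree on $[n]$ if and only if $|Z| \equiv \binom{n-1}{2} \pmod 2$.
   Context: All chains are over $\mathbb{F}_2$ and are identified with their supports (sets of simplices); addition is symmetric difference. A $d$-simplex is a $(d+1)$-element subset of $[n]$. The boundary $\partial X$ of a set $X$ of $d$-simplices is the set of $(d-1)$-simplices contained in an odd number of members of $X$. A set $Z$ of $d$-simplices is a $d$-cycle if $\partial Z=\emptyset$; the empty set is the trivial cycle. A set $F$ of $d$-simplices on $[n]$ is a $d$-forest (acyclic) if no nonempty subset of $F$ is a $d$-cycle; a $d$-hypertree on $[n]$ is an inclusion-maximal $d$-forest among all $d$-simplices on $[n]$ (every $d$-hypertree on $[n]$ has exactly $\binom{n-1}{d}$ simplices). *)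

theory Defs
  imports Main "HOL-Number_Theory.Cong"
begin

text \<open>
  The vertex set \<open>[n]\<close> is \<open>{1..n}\<close>. A chain over the two-element field is identified with
  its support, a set of simplices.
\<close>

definition simplices :: "nat \<Rightarrow> nat \<Rightarrow> nat set set" where
  "simplices n d = {s. s \<subseteq> {1..n} \<and> card s = d + 1}"

text \<open>
  A \<open>(d - 1)\<close>-simplex is written as a \<open>d\<close>-element subset of \<open>[n]\<close>, which avoids truncated
  subtraction; for \<open>d = 0\<close> this is the augmented (reduced) boundary.
\<close>

definition boundary :: "nat \<Rightarrow> nat \<Rightarrow> nat set set \<Rightarrow> nat set set" where
  "boundary n d X = {t. t \<subseteq> {1..n} \<and> card t = d \<and> odd (card {s \<in> X. t \<subseteq> s})}"

definition is_cycle :: "nat \<Rightarrow> nat \<Rightarrow> nat set set \<Rightarrow> bool" where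
  "is_cycle n d Z \<longleftrightarrow> Z \<subseteq> simplices n d \<and> boundary n d Z = {}"

definition is_forest :: "nat \<Rightarrow> nat \<Rightarrow> nat set set \<Rightarrow> bool" where
  "is_forest n d F \<longleftrightarrow>
     F \<subseteq> simplices n d \<and> (\<forall>Z. Z \<subseteq> F \<and> Z \<noteq> {} \<longrightarrow> \<not> is_cycle n d Z)"

definition is_hypertree :: "nat \<Rightarrow> nat \<Rightarrow> nat set set \<Rightarrow> bool" where
  "is_hypertree n d T \<longleftrightarrow>
     is_forest n d T \<and> (\<forall>F. is_forest n d F \<and> T \<subseteq> F \<longrightarrow> F = T)"

end

theory Submission
  imports Defs
begin

text \<open>
  Necessity is a parity count: a triangle has three edges, and every hypertree has
  \<open>(n - 1) choose 2\<close> triangles.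

  For sufficiency, induct on the number of vertices. Pick a vertex \<open>v\<close> of \<open>Z\<close>; its set of
  neighbours is nonempty of even size, so it is the set of odd-degree vertices of a spanning
  tree \<open>G\<close> on the remaining vertices. With \<open>Z - v\<close> denoting the edges of \<open>Z\<close> that avoid \<open>v\<close>,
  the cycle \<open>(Z - v) + G\<close> again has the right parity, and if a hypertree \<open>T\<close> on the remaining
  vertices fills it, then \<open>T\<close> together with the cone from \<open>v\<close> over \<open>G\<close> is a hypertree with
  boundary \<open>Z\<close>. The only danger is \<open>G = Z - v\<close>: with at least five vertices there are two choices
  of \<open>G\<close>, with four vertices parity excludes it, and with three vertices it is harmless, because
  on two vertices the empty cycle bounds the empty hypertree.
\<close>

subsection \<open>Boundaries and cones\<close>

text \<open>The boundary is augmented: an odd number of vertices has boundary \<open>{{}}\<close>.\<close>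

definition bd :: "'a set set \<Rightarrow> 'a set set" where
  "bd X = {t. odd (card {s \<in> X. \<exists>x. x \<notin> t \<and> s = insert x t})}"

definition acyclic_family :: "'a set set \<Rightarrow> bool" where
  "acyclic_family X \<longleftrightarrow> (\<forall>Y \<subseteq> X. bd Y = {} \<longrightarrow> Y = {})"

abbreviation cone :: "'a \<Rightarrow> 'a set set \<Rightarrow> 'a set set" where
  "cone v G \<equiv> insert v ` G"

definition antistar :: "'a \<Rightarrow> 'a set set \<Rightarrow> 'a set set" where
  "antistar v X = {s \<in> X. v \<notin> s}"

text \<open>For a graph these are the neighbours of \<open>v\<close>, each written as a singleton,
  so that an even number of neighbours is a cycle one dimension lower.\<close>

definition link :: "'a \<Rightarrow> 'a set set \<Rightarrow> 'a set set" where
  "link v X = {s. v \<notin> s \<and> insert v s \<in> X}"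

text \<open>The index is the number of vertices, one more than the dimension, so the augmented
  boundary goes from \<open>Suc k\<close> to \<open>k\<close>. The vertex set is arbitrary because
  the inductions delete vertices.\<close>

definition faces :: "'a set \<Rightarrow> nat \<Rightarrow> 'a set set" where
  "faces V k = {s. s \<subseteq> V \<and> card s = k}"

lemma odd_card_sym_diff:
  assumes "finite A" "finite B"
  shows "odd (card (sym_diff A B)) \<longleftrightarrow> (odd (card A) \<longleftrightarrow> even (card B))"
proof -
  have "card A = card (A - B) + card (A \<inter> B)" "card B = card (B - A) + card (A \<inter> B)"
    using assms card_Diff_subset_Int[of A B] card_Diff_subset_Int[of B A]
      card_mono[of A "A \<inter> B"] card_mono[of B "A \<inter> B"]
    by (auto simp: Int_commute)
  moreover have "card (sym_diff A B) = card (A - B) + card (B - A)"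
    using assms by (intro card_Un_disjoint) auto
  ultimately show ?thesis by presburger
qed

lemma bd_empty [simp]: "bd {} = {}"
  by (simp add: bd_def)

lemma bd_sym_diff:
  assumes "finite X" "finite Y"
  shows "bd (sym_diff X Y) = sym_diff (bd X) (bd Y)"
proof -
  have "t \<in> bd (sym_diff X Y) \<longleftrightarrow> \<not> (t \<in> bd X \<longleftrightarrow> t \<in> bd Y)" for t
  proof -
    let ?c = "\<lambda>X. {s \<in> X. \<exists>x. x \<notin> t \<and> s = insert x t}"
    have "?c (sym_diff X Y) = sym_diff (?c X) (?c Y)" by auto
    moreover have "finite (?c X)" "finite (?c Y)" using assms by auto
    ultimately have "odd (card (?c (sym_diff X Y))) \<longleftrightarrow> (odd (card (?c X)) \<longleftrightarrow> even (card (?c Y)))"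
      using odd_card_sym_diff[of "?c X" "?c Y"] by simp
    then show ?thesis unfolding bd_def mem_Collect_eq by argo
  qed
  then show ?thesis by blast
qed

lemma bd_faceE:
  assumes "t \<in> bd X"
  obtains x where "x \<notin> t" "insert x t \<in> X"
proof -
  have "{s \<in> X. \<exists>x. x \<notin> t \<and> s = insert x t} \<noteq> {}"
    using assms unfolding bd_def by (metis (mono_tags, lifting) card.empty even_zero mem_Collect_eq)
  then show ?thesis using that by auto
qed

lemma bd_faces:
  assumes "X \<subseteq> faces V (Suc k)"
  shows "bd X \<subseteq> faces V k"
proof
  fix t assume "t \<in> bd X"
  then obtain x where x: "x \<notin> t" "insert x t \<in> X" by (rule bd_faceE)
  then have "insert x t \<subseteq> V" "card (insert x t) = Suc k"
    using assms by (auto simp: faces_def)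
  moreover have "finite t" using \<open>card (insert x t) = Suc k\<close>
    by (metis card.infinite finite_insert nat.simps(3))
  ultimately show "t \<in> faces V k" using x by (auto simp: faces_def)
qed

lemma finite_faces: "finite V \<Longrightarrow> finite (faces V k)"
  by (simp add: faces_def)

lemma card_faces: "finite V \<Longrightarrow> card (faces V k) = card V choose k"
  by (simp add: faces_def n_subsets)

text \<open>Removing the apex from a coned simplex returns its base; removing another vertex gives
  the cone over a facet of the base.\<close>

lemma bd_cone:
  assumes "\<forall>g\<in>G. v \<notin> g"
  shows "bd (cone v G) = sym_diff G (cone v (bd G))"
proof -
  have nv: "\<forall>g\<in>bd G. v \<notin> g" using assms by (metis bd_faceE insertCI)
  let ?c = "\<lambda>t X. {s \<in> X. \<exists>x. x \<notin> t \<and> s = insert x t}"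
  have "t \<in> bd (cone v G) \<longleftrightarrow> t \<in> sym_diff G (cone v (bd G))" for t
  proof (cases "v \<in> t")
    \<comment> \<open>A face without the apex can only be completed to a coned simplex by adding
      \<open>v\<close> itself.\<close>
    case False
    have "s \<in> ?c t (cone v G) \<longleftrightarrow> s \<in> (if t \<in> G then {insert v t} else {})" for s
    proof
      assume "s \<in> ?c t (cone v G)"
      then obtain g x where gx: "g \<in> G" "s = insert v g" "x \<notin> t" "s = insert x t" by auto
      then have "v \<in> insert x t" by blast
      then have "x = v" using False by simp
      then have "g = t" using gx False assms by (metis insert_ident)
      then show "s \<in> (if t \<in> G then {insert v t} else {})" using gx by simp
    next
      assume "s \<in> (if t \<in> G then {insert v t} else {})"
      then show "s \<in> ?c t (cone v G)" using False by (auto split: if_splits)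
    qed
    then have "?c t (cone v G) = (if t \<in> G then {insert v t} else {})" by blast
    then have "t \<in> bd (cone v G) \<longleftrightarrow> t \<in> G" unfolding bd_def by simp
    then show ?thesis using False by blast
  next
    case True
    define u where "u = t - {v}"
    have t: "t = insert v u" "v \<notin> u" using True by (auto simp: u_def)
    \<comment> \<open>A face with the apex is the cone over \<open>u\<close>, and its cofaces are
      the cones over the cofaces of \<open>u\<close>.\<close>
    have "?c t (cone v G) = cone v (?c u G)"
    proof (intro equalityI subsetI)
      fix s assume "s \<in> ?c t (cone v G)"
      then obtain g x where gx: "g \<in> G" "s = insert v g" "x \<notin> t" "s = insert x t" by auto
      have "g = s - {v}" using gx(1,2) assms by auto
      then have "g = insert x u" using gx t by auto
      then show "s \<in> cone v (?c u G)" using gx t by auto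
    next
      fix s assume "s \<in> cone v (?c u G)"
      then obtain x where "x \<notin> u" "insert x u \<in> G" "s = insert v (insert x u)" by auto
      moreover from this have "x \<notin> t" using assms t by auto
      ultimately show "s \<in> ?c t (cone v G)" using t by (auto simp: insert_commute)
    qed
    moreover have "inj_on (insert v) (?c u G)"
      using assms by (intro inj_onI) (metis (mono_tags, lifting) insert_ident mem_Collect_eq)
    ultimately have "card (?c t (cone v G)) = card (?c u G)" by (simp add: card_image)
    then have "t \<in> bd (cone v G) \<longleftrightarrow> u \<in> bd G" by (simp add: bd_def)
    also have "\<dots> \<longleftrightarrow> t \<in> cone v (bd G)" using t nv by (metis (no_types, lifting) imageE imageI insert_ident)
    finally show ?thesis using True assms by auto
  qed
  then show ?thesis by blast
qed

section \<open>Splitting a family at a vertex\<close>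

lemma finite_antistar: "finite X \<Longrightarrow> finite (antistar v X)"
  by (simp add: antistar_def)

lemma cone_link: "cone v (link v X) = {s \<in> X. v \<in> s}"
proof (intro equalityI subsetI)
  fix s assume "s \<in> {s \<in> X. v \<in> s}"
  then have "s - {v} \<in> link v X" "s = insert v (s - {v})" by (auto simp: link_def insert_absorb)
  then show "s \<in> cone v (link v X)" by (rule rev_image_eqI)
qed (auto simp: link_def)

lemma inj_cone: "\<forall>g\<in>G. v \<notin> g \<Longrightarrow> inj_on (insert v) G"
  by (intro inj_onI) (metis insert_ident)

lemma link_avoids: "\<forall>g\<in>link v X. v \<notin> g"
  by (simp add: link_def)

lemma finite_link: "finite X \<Longrightarrow> finite (link v X)"
  using finite_imageD[OF _ inj_cone[OF link_avoids[of v X]]] by (simp add: cone_link)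

lemma card_antistar_link:
  assumes "finite X"
  shows "card X = card (antistar v X) + card (link v X)"
proof -
  have "card (link v X) = card {s \<in> X. v \<in> s}"
    using card_image[OF inj_cone[OF link_avoids]] by (metis cone_link)
  moreover have "X = antistar v X \<union> {s \<in> X. v \<in> s}" by (auto simp: antistar_def)
  moreover have "card (antistar v X \<union> {s \<in> X. v \<in> s}) = card (antistar v X) + card {s \<in> X. v \<in> s}"
    using assms by (intro card_Un_disjoint) (auto simp: antistar_def)
  ultimately show ?thesis by metis
qed

lemma decompose: "X = sym_diff (antistar v X) (cone v (link v X))"
  unfolding cone_link by (auto simp: antistar_def)

lemma bd_antistar_link:
  assumes "finite X"
  shows "bd X = sym_diff (bd (antistar v X)) (sym_diff (link v X) (cone v (bd (link v X))))"
proof -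
  have "bd X = bd (sym_diff (antistar v X) (cone v (link v X)))"
    using decompose[of X v] by simp
  also have "\<dots> = sym_diff (bd (antistar v X)) (bd (cone v (link v X)))"
    using assms by (intro bd_sym_diff) (auto simp: finite_link finite_antistar)
  finally show ?thesis unfolding bd_cone[OF link_avoids] .
qed

text \<open>In the split boundary only the cone over \<open>bd (link v X)\<close> has faces
  containing \<open>v\<close>, so it vanishes by itself; what is left equates the other two
  summands.\<close>

lemma cycle_antistar_link:
  assumes "finite X" "bd X = {}"
  shows "bd (antistar v X) = link v X" "bd (link v X) = {}"
proof -
  have e: "bd (antistar v X) = sym_diff (link v X) (cone v (bd (link v X)))"
    using bd_antistar_link[OF assms(1), of v] assms(2) by blast
  have nv: "\<forall>t\<in>bd (antistar v X). v \<notin> t"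
    by (metis (no_types, lifting) antistar_def bd_faceE insertCI mem_Collect_eq)
  have "cone v (bd (link v X)) = {}"
  proof (rule ccontr)
    assume "cone v (bd (link v X)) \<noteq> {}"
    then obtain t where "t \<in> cone v (bd (link v X))" by blast
    moreover from this have "t \<notin> link v X" by (auto simp: link_def)
    ultimately have "t \<in> bd (antistar v X)" "v \<in> t" unfolding e by auto
    then show False using nv by blast
  qed
  then show "bd (antistar v X) = link v X" "bd (link v X) = {}" using e by auto
qed

text \<open>The link at \<open>v\<close> of a cycle in the union is a cycle inside \<open>G\<close>,
  hence empty; the rest of the cycle then lies in \<open>T\<close> and is empty too.\<close>

lemma acyclic_cone:
  assumes "acyclic_family T" "acyclic_family G" "finite T" "finite G"
    and "\<forall>s\<in>T. v \<notin> s" "\<forall>s\<in>G. v \<notin> s"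
  shows "acyclic_family (T \<union> cone v G)"
  unfolding acyclic_family_def
proof (intro allI impI)
  fix Y assume Y: "Y \<subseteq> T \<union> cone v G" and cyc: "bd Y = {}"
  have fin: "finite Y" using Y assms(3,4) by (meson finite_UnI finite_imageI finite_subset)
  have "link v Y \<subseteq> G"
  proof
    fix s assume "s \<in> link v Y"
    then have "v \<notin> s" "insert v s \<in> cone v G" using Y assms(5) by (auto simp: link_def)
    then obtain g where "g \<in> G" "insert v s = insert v g" by blast
    then show "s \<in> G" using \<open>v \<notin> s\<close> assms(6) by (metis insert_ident)
  qed
  then have L: "link v Y = {}"
    using assms(2) cycle_antistar_link(2)[OF fin cyc] by (simp add: acyclic_family_def)
  have "antistar v Y \<subseteq> T" using Y by (auto simp: antistar_def)
  then have "antistar v Y = {}"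
    using assms(1) cycle_antistar_link(1)[OF fin cyc, of v] L by (simp add: acyclic_family_def)
  then show "Y = {}" using L decompose[of Y v] by simp
qed

text \<open>
  The induction step for trees and for hypertrees alike: a filling of
  \<open>antistar v Z + G\<close> extends over the cone of any \<open>G\<close> that fills the link of \<open>v\<close>.
\<close>

lemma cone_step:
  assumes "finite Z" "bd Z = {}" "finite G" "finite T"
    and "bd G = link v Z"
    and "bd T = sym_diff (antistar v Z) G"
    and "\<forall>s\<in>T. v \<notin> s" "\<forall>s\<in>G. v \<notin> s"
  shows "bd (T \<union> cone v G) = Z" "card (T \<union> cone v G) = card T + card G"
proof -
  have disj: "T \<inter> cone v G = {}" using assms(7) by blast
  then have "bd (T \<union> cone v G) = bd (sym_diff T (cone v G))" by (metis Diff_triv Int_commute)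
  also have "\<dots> = sym_diff (bd T) (bd (cone v G))"
    using assms by (intro bd_sym_diff) auto
  also have "\<dots> = sym_diff (sym_diff (antistar v Z) G) (sym_diff G (cone v (link v Z)))"
    using assms by (simp add: bd_cone)
  also have "\<dots> = sym_diff (antistar v Z) (cone v (link v Z))" by blast
  finally show "bd (T \<union> cone v G) = Z" using decompose[of Z v] by simp
  show "card (T \<union> cone v G) = card T + card G"
    using assms disj by (simp add: card_Un_disjoint card_image inj_cone)
qed

text \<open>Both summands have boundary \<open>link v Z\<close>, which cancels. This is the cycle
  left to be filled once \<open>v\<close> is deleted.\<close>

lemma bd_residue:
  assumes "finite Z" "bd Z = {}" "finite G" "bd G = link v Z"
  shows "bd (sym_diff (antistar v Z) G) = {}"
  using assms by (simp add: bd_sym_diff cycle_antistar_link finite_antistar)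

subsection \<open>Fillings of cycles by trees and hypertrees\<close>

lemma antistar_faces: "X \<subseteq> faces V k \<Longrightarrow> antistar v X \<subseteq> faces (V - {v}) k"
  by (auto simp: antistar_def faces_def)

lemma link_faces:
  assumes "finite V" "X \<subseteq> faces V (Suc k)"
  shows "link v X \<subseteq> faces (V - {v}) k"
proof
  fix s assume "s \<in> link v X"
  then have s: "v \<notin> s" "insert v s \<subseteq> V" "card (insert v s) = Suc k"
    using assms(2) by (auto simp: link_def faces_def)
  moreover have "finite s" using s(2) assms(1) by (meson finite_subset subset_insertI subset_trans)
  ultimately show "s \<in> faces (V - {v}) k" by (auto simp: faces_def)
qed

lemma cone_faces:
  assumes "finite V" "v \<in> V" "G \<subseteq> faces (V - {v}) k"
  shows "cone v G \<subseteq> faces V (Suc k)"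
proof
  fix s assume "s \<in> cone v G"
  then obtain g where g: "s = insert v g" "g \<subseteq> V - {v}" "card g = k"
    using assms(3) by (auto simp: faces_def)
  moreover have "finite g" using g(2) assms(1) by (meson finite_Diff finite_subset)
  moreover have "v \<notin> g" using g(2) by blast
  ultimately show "s \<in> faces V (Suc k)" using assms(2) by (auto simp: faces_def)
qed

lemma faces_mono: "U \<subseteq> V \<Longrightarrow> faces U k \<subseteq> faces V k"
  by (auto simp: faces_def)

lemma faces_avoid: "X \<subseteq> faces (V - {v}) k \<Longrightarrow> \<forall>s\<in>X. v \<notin> s"
  by (auto simp: faces_def)

text \<open>Used with \<open>k = 0\<close> to attach a leaf to a tree and with \<open>k = 1\<close>
  to attach a cone of triangles to a hypertree.\<close>

lemma cone_step_faces:
  assumes "finite V" "v \<in> V" "Z \<subseteq> faces V (Suc k)" "bd Z = {}"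
    and "G \<subseteq> faces (V - {v}) (Suc k)" "acyclic_family G" "bd G = link v Z"
    and "T \<subseteq> faces (V - {v}) (Suc (Suc k))" "acyclic_family T"
    and "bd T = sym_diff (antistar v Z) G"
  shows "T \<union> cone v G \<subseteq> faces V (Suc (Suc k))" "acyclic_family (T \<union> cone v G)"
    "bd (T \<union> cone v G) = Z" "card (T \<union> cone v G) = card T + card G"
proof -
  have fin: "finite Z" "finite G" "finite T"
    using assms(1,3,5,8) by (meson finite_Diff finite_faces finite_subset)+
  note avoid = faces_avoid[OF assms(5)] faces_avoid[OF assms(8)]
  show "T \<union> cone v G \<subseteq> faces V (Suc (Suc k))"
    using cone_faces[OF assms(1,2,5)] assms(8) faces_mono[of "V - {v}" V] by blast
  show "acyclic_family (T \<union> cone v G)"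
    by (rule acyclic_cone[OF assms(9,6) fin(3,2) avoid(2,1)])
  show "bd (T \<union> cone v G) = Z" "card (T \<union> cone v G) = card T + card G"
    by (rule cone_step[OF fin(1) assms(4) fin(2,3) assms(7,10) avoid(2,1)])+
qed

text \<open>The augmentation at work: every vertex covers the empty face once.\<close>

lemma vertex_cycle_even:
  assumes "L \<subseteq> faces W 1" "bd L = {}"
  shows "even (card L)"
proof -
  have "{s \<in> L. \<exists>x. x \<notin> {} \<and> s = insert x {}} = L"
    using assms(1) by (auto simp: faces_def card_1_singleton_iff)
  moreover have "{} \<notin> bd L" using assms(2) by blast
  ultimately show ?thesis by (simp add: bd_def)
qed

section \<open>Trees with prescribed odd-degree vertices\<close>

lemma acyclic_empty: "acyclic_family {}"
  by (simp add: acyclic_family_def)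

lemma faces_singletonE:
  assumes "s \<in> faces W 1"
  obtains w where "w \<in> W" "s = {w}"
  using assms by (auto simp: faces_def card_1_singleton_iff)

text \<open>At most one \<open>u\<close> makes \<open>L\<close> the pair of \<open>w\<close> and
  \<open>u\<close>, so only \<open>w\<close> and that vertex are lost. Such a \<open>u\<close> is a
  bad place to hang the leaf \<open>w\<close>, as no odd vertex would remain.\<close>

lemma card_good_leaves:
  assumes "finite W" "w \<in> W"
  shows "card W - 2 \<le> card {u \<in> W - {w}. L \<noteq> {{w}, {u}}}"
proof -
  obtain b where b: "\<forall>u\<in>W - {w}. L = {{w}, {u}} \<longrightarrow> u = b"
  proof (cases "\<exists>b\<in>W - {w}. L = {{w}, {b}}")
    case True
    then obtain b where "b \<in> W - {w}" "L = {{w}, {b}}" by blast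
    then have "\<forall>u\<in>W - {w}. L = {{w}, {u}} \<longrightarrow> u = b" by (auto simp: doubleton_eq_iff)
    then show ?thesis by (rule that)
  qed (use that in blast)
  have "card W - card {w, b} \<le> card (W - {w, b})" by (intro diff_card_le_card_Diff) simp
  moreover have "card {w, b} \<le> 2" by (simp add: card_insert_if)
  moreover have "card (W - {w, b}) \<le> card {u \<in> W - {w}. L \<noteq> {{w}, {u}}}"
    using b assms(1) by (intro card_mono) auto
  ultimately show ?thesis by linarith
qed

lemma bd_vertex: "bd {{u}} = {{}}"
proof -
  have "{s \<in> {{u}}. \<exists>x. x \<notin> t \<and> s = insert x t} = (if t = {} then {{u}} else {})" for t
    by (auto simp: insert_eq_iff)
  then show ?thesis by (auto simp: bd_def)
qed

lemma acyclic_vertex: "acyclic_family {{u}}"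
  using bd_vertex[of u] by (auto simp: acyclic_family_def subset_singleton_iff)

lemma link_vertices:
  assumes "L \<subseteq> faces W 1" "{w} \<in> L"
  shows "link w L = {{}}"
proof -
  have "s = {}" if "s \<in> link w L" for s
  proof -
    have "w \<notin> s" "insert w s \<in> faces W 1" using that assms by (auto simp: link_def)
    then obtain x where "w \<notin> s" "insert w s = {x}" by (metis faces_singletonE)
    then show "s = {}" by blast
  qed
  then show ?thesis using assms(2) by (auto simp: link_def)
qed

text \<open>The cone from \<open>w\<close> over the vertex \<open>u\<close> is a single edge. The
  link is recorded because the neighbour of the leaf \<open>w\<close> later tells trees
  apart.\<close>

lemma attach_leaf:
  assumes "finite W" "L \<subseteq> faces W 1" "bd L = {}" "{w} \<in> L" "u \<in> W - {w}"
    and "G \<subseteq> faces (W - {w}) 2" "acyclic_family G"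
    and "bd G = sym_diff (antistar w L) {{u}}"
  shows "\<exists>H \<subseteq> faces W 2. acyclic_family H \<and> card H = Suc (card G) \<and> bd H = L \<and> link w H = {{u}}"
proof -
  let ?H = "G \<union> cone w {{u}}"
  have "w \<in> W" using assms(2,4) by (auto simp: faces_def)
  moreover have "{{u}} \<subseteq> faces (W - {w}) (Suc 0)" using assms(5) by (auto simp: faces_def)
  ultimately have H: "?H \<subseteq> faces W 2" "acyclic_family ?H" "bd ?H = L" "card ?H = Suc (card G)"
    using cone_step_faces[of W w L 0 "{{u}}" G] assms
    by (simp_all add: numeral_2_eq_2 acyclic_vertex bd_vertex link_vertices)
  have "link w ?H = {{u}}"
  proof (intro equalityI subsetI)
    fix s assume "s \<in> link w ?H"
    moreover have "insert w s \<notin> G" using assms(6) by (auto simp: faces_def)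
    ultimately have "w \<notin> s" "insert w s = insert w {u}" by (auto simp: link_def)
    then show "s \<in> {{u}}" using assms(5) by auto
  qed (use assms(5) in \<open>auto simp: link_def\<close>)
  then show ?thesis using H by blast
qed

text \<open>Make \<open>w\<close> a leaf at \<open>u\<close> and recurse on the other vertices with
  \<open>u\<close> toggled in the odd set. That set must not become empty while two or more vertices
  remain, since a tree on them has leaves; this is the last assumption.\<close>

lemma exists_tree_with_leaf:
  assumes "finite W" "card W = Suc (Suc m)" "L \<subseteq> faces W 1" "bd L = {}"
    and "{w} \<in> L" "u \<in> W - {w}" "L \<noteq> {{w}, {u}} \<or> m = 0"
  shows "\<exists>G \<subseteq> faces W 2. acyclic_family G \<and> card G = Suc m \<and> bd G = L \<and> link w G = {{u}}"
  using assms
proof (induction m arbitrary: W L w u)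
  case (0 W L w u)
  let ?L = "sym_diff (antistar w L) {{u}}"
  have "w \<in> W" using "0.prems" by (auto simp: faces_def)
  then have "card (W - {w}) = 1" using "0.prems" by simp
  then have W: "W - {w} = {u}" using "0.prems"(6) by (metis One_nat_def card_1_singleton_iff singletonD)
  have fin: "finite L" using "0.prems" by (meson finite_faces finite_subset)
  have sub: "antistar w L \<subseteq> faces {u} 1" using antistar_faces[OF "0.prems"(3), of w] W by simp
  then have L: "?L \<subseteq> {{u}}" by (auto simp: faces_def card_1_singleton_iff)
  \<comment> \<open>Only \<open>u\<close> is left, and an even subset of one vertex is empty, so the
    single edge suffices.\<close>
  have "even (card ?L)"
  proof (rule vertex_cycle_even)
    show "?L \<subseteq> faces {u} 1" using L by (auto simp: faces_def)
    show "bd ?L = {}" using "0.prems" fin by (intro bd_residue) (auto simp: bd_vertex link_vertices)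
  qed
  then have "?L = {}" using L by (metis subset_singleton_iff is_singletonI is_singleton_altdef odd_one)
  then show ?case
    using attach_leaf[of W L w u "{}"] "0.prems" by (simp add: acyclic_empty)
next
  case (Suc m W L w u)
  define N where "N = sym_diff (antistar w L) {{u}}"
  let ?W = "W - {w}"
  have "w \<in> W" using Suc.prems by (auto simp: faces_def)
  then have W: "finite ?W" "card ?W = Suc (Suc m)" using Suc.prems by simp_all
  have fin: "finite L" using Suc.prems by (meson finite_faces finite_subset)
  have N: "N \<subseteq> faces ?W 1"
    using antistar_faces[OF Suc.prems(3), of w] Suc.prems(6) by (auto simp: N_def faces_def)
  have cyc: "bd N = {}"
    unfolding N_def using Suc.prems fin by (intro bd_residue) (auto simp: bd_vertex link_vertices)
  \<comment> \<open>If no odd vertex were left, \<open>L\<close> would be exactly the excluded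
    pair.\<close>
  have "N \<noteq> {}"
  proof
    assume "N = {}"
    then have "antistar w L = {{u}}" unfolding N_def by blast
    then have "L = sym_diff {{u}} (cone w {{}})"
      using decompose[of L w] link_vertices[OF Suc.prems(3,5)] by simp
    then show False using Suc.prems(6,7) by auto
  qed
  then obtain x where x: "{x} \<in> N" using N by (metis (no_types, lifting) all_not_in_conv faces_singletonE subsetD)
  have "x \<in> ?W" using x N by (auto simp: faces_def)
  \<comment> \<open>The next leaf is \<open>x\<close>; a neighbour \<open>y\<close> is needed that
    meets the assumption of the induction hypothesis.\<close>
  have "\<exists>y \<in> ?W - {x}. N \<noteq> {{x}, {y}} \<or> m = 0"
  proof (cases "m = 0")
    case True
    have "?W - {x} \<noteq> {}" using W \<open>x \<in> ?W\<close> by (metis card.empty card_Suc_Diff1 nat.distinct(1) nat.inject)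
    then show ?thesis using True by blast
  next
    case False
    have "card ?W - 2 \<le> card {y \<in> ?W - {x}. N \<noteq> {{x}, {y}}}"
      by (rule card_good_leaves[OF W(1) \<open>x \<in> ?W\<close>])
    then have "0 < card {y \<in> ?W - {x}. N \<noteq> {{x}, {y}}}" using False W(2) by linarith
    then have "{y \<in> ?W - {x}. N \<noteq> {{x}, {y}}} \<noteq> {}" unfolding card_gt_0_iff by (rule conjunct1)
    then show ?thesis by blast
  qed
  then obtain y where y: "y \<in> ?W - {x}" "N \<noteq> {{x}, {y}} \<or> m = 0" by blast
  obtain G where G: "G \<subseteq> faces ?W 2" "acyclic_family G" "card G = Suc m" "bd G = N"
    using Suc.IH[OF W N cyc x y] by blast
  show ?case using attach_leaf[OF Suc.prems(1,3,4,5,6) G(1,2) G(4)[unfolded N_def]] G(3) by simp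
qed

text \<open>From four vertices on, two different leaves provide two different trees.\<close>

lemma exists_tree:
  assumes "finite W" "card W = Suc m" "L \<subseteq> faces W 1" "bd L = {}" "L \<noteq> {}"
  obtains G where "G \<subseteq> faces W 2" "acyclic_family G" "card G = m" "bd G = L"
    "3 \<le> m \<Longrightarrow> G \<noteq> H"
proof -
  have fin: "finite L" using assms(1,3) by (meson finite_faces finite_subset)
  obtain w where w: "{w} \<in> L" using assms(3,5) by (metis all_not_in_conv faces_singletonE subsetD)
  have wW: "w \<in> W" using w assms(3) by (auto simp: faces_def)
  have "even (card L)" by (rule vertex_cycle_even[OF assms(3,4)])
  \<comment> \<open>Evenness supplies a second odd vertex, so there are at least two vertices and
    \<open>m\<close> is positive.\<close>
  then have "L \<noteq> {{w}}" by auto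
  then obtain x where x: "{x} \<in> L" "x \<noteq> w" using w assms(3)
    by (metis faces_singletonE subsetD subsetI subset_singletonD insertI1 empty_iff singletonD)
  have xW: "x \<in> W - {w}" using x assms(3) by (auto simp: faces_def)
  then have "m \<noteq> 0" using assms(1,2) wW by (metis DiffE card_1_singleton_iff One_nat_def singletonD singletonI)
  then obtain k where k: "m = Suc k" by (metis not0_implies_Suc)
  let ?good = "{u \<in> W - {w}. L \<noteq> {{w}, {u}}}"
  have good: "k \<le> card ?good" using card_good_leaves[OF assms(1) wW, of L] assms(2) k by simp
  have tree: "\<exists>G \<subseteq> faces W 2. acyclic_family G \<and> card G = m \<and> bd G = L \<and> link w G = {{u}}"
    if "u \<in> W - {w}" "L \<noteq> {{w}, {u}} \<or> k = 0" for u
    using exists_tree_with_leaf[OF assms(1) _ assms(3,4) w that] assms(2) k by simp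
  show thesis
  proof (cases "3 \<le> m")
    case True
    then have "2 \<le> card ?good" using good k by simp
    then obtain S where "S \<subseteq> ?good" "card S = 2" by (meson obtain_subset_with_card_n)
    then obtain a b where ab: "a \<in> ?good" "b \<in> ?good" "a \<noteq> b"
      unfolding card_2_iff by blast
    obtain G where G: "G \<subseteq> faces W 2" "acyclic_family G" "card G = m" "bd G = L" "link w G = {{a}}"
      using tree[of a] ab(1) by blast
    obtain G' where G': "G' \<subseteq> faces W 2" "acyclic_family G'" "card G' = m" "bd G' = L" "link w G' = {{b}}"
      using tree[of b] ab(2) by blast
    \<comment> \<open>The leaf \<open>w\<close> has different neighbours in the two trees, so at
      most one of them equals \<open>H\<close>.\<close>
    have "G \<noteq> G'" using G(5) G'(5) ab(3) by auto
    then show thesis using that[OF G(1-4)] that[OF G'(1-4)] by blast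
  next
    case False
    have "\<exists>u \<in> W - {w}. L \<noteq> {{w}, {u}} \<or> k = 0"
    proof (cases "k = 0")
      case False
      then have "0 < card ?good" using good by linarith
      then have "?good \<noteq> {}" unfolding card_gt_0_iff by (rule conjunct1)
      then show ?thesis by blast
    qed (use xW in blast)
    then obtain u where "u \<in> W - {w}" "L \<noteq> {{w}, {u}} \<or> k = 0" by blast
    then show thesis using tree that False by blast
  qed
qed

text \<open>The empty cycle is allowed only for \<open>m \<le> 1\<close>, where
  \<open>m choose 2\<close> is zero: a nonempty acyclic family has nonempty boundary.\<close>

lemma exists_acyclic_filling:
  assumes "finite V" "card V = Suc m" "Z \<subseteq> faces V 2" "bd Z = {}"
    and "Z \<noteq> {} \<or> m \<le> 1" "even (card Z) \<longleftrightarrow> even (m choose 2)"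
  shows "\<exists>T \<subseteq> faces V 3. acyclic_family T \<and> card T = m choose 2 \<and> bd T = Z"
  using assms
proof (induction m arbitrary: V Z)
  case (0 V Z)
  obtain a where "V = {a}" using "0.prems" by (auto simp: card_1_singleton_iff)
  then have "faces V 2 = {}" by (auto simp: faces_def subset_singleton_iff)
  then show ?case using "0.prems" by (intro exI[of _ "{}"]) (simp add: acyclic_empty)
next
  case (Suc m V Z)
  show ?case
  proof (cases "Z = {}")
    case True
    then have "m = 0" using Suc.prems(5) by simp
    then show ?thesis using True by (intro exI[of _ "{}"]) (simp add: acyclic_empty)
  next
    case False
    then obtain e where "e \<in> Z" by blast
    moreover have "e \<noteq> {}" using calculation Suc.prems(3) by (auto simp: faces_def)
    ultimately obtain v where v: "v \<in> e" "e \<in> Z" by blast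
    let ?V = "V - {v}" and ?L = "link v Z"
    have vV: "v \<in> V" using v Suc.prems(3) by (auto simp: faces_def)
    have V: "finite ?V" "card ?V = Suc m" using Suc.prems(1,2) vV by simp_all
    have fin: "finite Z" using Suc.prems(1,3) by (meson finite_faces finite_subset)
    have L: "?L \<subseteq> faces ?V 1"
      using link_faces[of V Z 1] Suc.prems(1,3) by (simp add: numeral_2_eq_2)
    have Lcyc: "bd ?L = {}" by (rule cycle_antistar_link(2)[OF fin Suc.prems(4)])
    have "e \<in> cone v ?L" unfolding cone_link using v by blast
    then have "?L \<noteq> {}" by blast
    obtain G where G: "G \<subseteq> faces ?V 2" "acyclic_family G" "card G = m" "bd G = ?L"
      and avoid: "3 \<le> m \<Longrightarrow> G \<noteq> antistar v Z"
      using exists_tree[OF V L Lcyc \<open>?L \<noteq> {}\<close>, where H = "antistar v Z"] by blast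
    have finG: "finite G" using G(1) V(1) by (meson finite_faces finite_subset)
    define Y where "Y = sym_diff (antistar v Z) G"
    have Lev: "even (card ?L)" by (rule vertex_cycle_even[OF L Lcyc])
    have cZ: "card Z = card (antistar v Z) + card ?L" by (rule card_antistar_link[OF fin])
    have ch: "Suc m choose 2 = m + (m choose 2)" by (simp add: numeral_2_eq_2)
    have Y: "Y \<subseteq> faces ?V 2" using antistar_faces[OF Suc.prems(3), of v] G(1) unfolding Y_def by blast
    have Ycyc: "bd Y = {}" unfolding Y_def by (rule bd_residue[OF fin Suc.prems(4) finG G(4)])
    have Yne: "Y \<noteq> {} \<or> m \<le> 1"
    proof (rule ccontr)
      assume "\<not> (Y \<noteq> {} \<or> m \<le> 1)"
      then have eq: "G = antistar v Z" and "2 \<le> m" unfolding Y_def by (blast, simp)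
      then have m: "m = 2" using avoid by fastforce
      \<comment> \<open>There are four vertices here: \<open>G\<close> has two edges and the link is
        even, so \<open>card Z\<close> is even, against \<open>3 choose 2 = 3\<close>.\<close>
      then have "even (card Z)" using cZ Lev G(3) eq by simp
      then show False using Suc.prems(6) ch m by simp
    qed
    \<comment> \<open>Modulo 2, passing from \<open>Z\<close> to \<open>Y\<close> drops the even
      link and adds the \<open>m\<close> edges of \<open>G\<close>, matching Pascal's rule in
      \<open>ch\<close>.\<close>
    have Yev: "even (card Y) \<longleftrightarrow> even (m choose 2)"
      using odd_card_sym_diff[OF finite_antistar[OF fin] finG, of v] Suc.prems(6) cZ ch Lev G(3)
      unfolding Y_def
      by (metis even_add)
    obtain T where T: "T \<subseteq> faces ?V 3" "acyclic_family T" "card T = m choose 2" "bd T = Y"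
      using Suc.IH[OF V Y Ycyc Yne Yev] by (elim exE conjE)
    have two: "Suc 1 = 2" and three: "Suc 2 = 3" by simp_all
    note step = cone_step_faces[of V v Z 1 G T, unfolded two three,
        OF Suc.prems(1) vV Suc.prems(3,4) G(1,2,4) T(1,2) T(4)[unfolded Y_def]]
    have "card (T \<union> cone v G) = Suc m choose 2" using step(4) ch T(3) G(3) by simp
    then show ?thesis using step(1-3) by blast
  qed
qed

subsection \<open>The rank of the boundary operator\<close>

lemma bd_insert:
  assumes "finite X" "s \<notin> X"
  shows "bd (insert s X) = sym_diff (bd {s}) (bd X)"
proof -
  have "insert s X = sym_diff {s} X" using assms(2) by blast
  then show ?thesis using bd_sym_diff[of "{s}" X] assms(1) by simp
qed

lemma finite_bd:
  assumes "finite X" "\<forall>s\<in>X. finite s"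
  shows "finite (bd X)"
proof (rule finite_subset)
  show "bd X \<subseteq> (\<Union>s\<in>X. Pow s)" by (auto elim!: bd_faceE)
qed (use assms in auto)

text \<open>A simplex is the cone over one of its facets, so two applications of the cone formula
  reduce the claim to that facet.\<close>

lemma bd_bd_singleton: "finite s \<Longrightarrow> bd (bd {s}) = {}"
proof (induction s rule: finite_induct)
  case empty
  have "bd {{} :: 'a set} = {}" by (auto elim: bd_faceE)
  then show ?case by simp
next
  case (insert v s)
  have nv: "\<forall>t\<in>bd {s}. v \<notin> t" using insert.hyps(2) by (metis bd_faceE insertCI singletonD)
  have fin: "finite (bd {s})" using insert.hyps(1) by (intro finite_bd) auto
  have "bd {insert v s} = sym_diff {s} (cone v (bd {s}))"
    using bd_cone[of "{s}" v] insert.hyps(2) by simp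
  then have "bd (bd {insert v s}) = sym_diff (bd {s}) (bd (cone v (bd {s})))"
    using fin by (simp add: bd_sym_diff)
  also have "bd (cone v (bd {s})) = sym_diff (bd {s}) (cone v {})"
    using bd_cone[OF nv] insert.IH by simp
  finally show ?case by simp
qed

lemma bd_bd:
  assumes "finite X" "\<forall>s\<in>X. finite s"
  shows "bd (bd X) = {}"
  using assms
proof (induction X rule: finite_induct)
  case (insert s X)
  have "finite (bd {s})" "finite (bd X)" using insert by (auto intro: finite_bd)
  then have "bd (sym_diff (bd {s}) (bd X)) = sym_diff (bd (bd {s})) (bd (bd X))"
    by (rule bd_sym_diff)
  then show ?case using insert bd_bd_singleton[of s] bd_insert[of X s] by simp
qed simp

lemma bd_singleton: "bd {s} = (\<lambda>x. s - {x}) ` s"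
proof -
  have "{r \<in> {s}. \<exists>x. x \<notin> t \<and> r = insert x t} = (if \<exists>x. x \<notin> t \<and> s = insert x t then {s} else {})" for t
    by auto
  then have "t \<in> bd {s} \<longleftrightarrow> (\<exists>x. x \<notin> t \<and> s = insert x t)" for t
    unfolding bd_def mem_Collect_eq by simp
  also have "\<dots> t \<longleftrightarrow> t \<in> (\<lambda>x. s - {x}) ` s" for t by (auto simp: image_iff insert_absorb)
  finally show ?thesis by blast
qed

lemma card_bd_singleton: "card (bd {s}) = card s"
  unfolding bd_singleton by (intro card_image inj_onI) blast

text \<open>Each simplex contributes \<open>k\<close> facets, an odd number, and symmetric
  differences add sizes modulo 2. For \<open>k = 3\<close> this is the necessity of the parity
  condition.\<close>

lemma odd_card_bd:
  assumes "finite X" "X \<subseteq> faces V k" "odd k" "finite V"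
  shows "odd (card (bd X)) \<longleftrightarrow> odd (card X)"
  using assms(1,2)
proof (induction X rule: finite_induct)
  case (insert s X)
  have f: "\<forall>r\<in>insert s X. finite r"
    using insert.prems assms(4) by (metis (mono_tags, lifting) faces_def finite_subset mem_Collect_eq subsetD)
  then have "finite (bd {s})" "finite (bd X)" using insert.hyps by (auto intro: finite_bd)
  moreover have "card (bd {s}) = k"
    using insert.prems by (simp add: card_bd_singleton faces_def)
  ultimately show ?case
    using odd_card_sym_diff[of "bd {s}" "bd X"] bd_insert[OF insert.hyps] insert assms(3) by simp
qed simp

text \<open>\<open>bd\<close> is linear and acyclicity says that its kernel on subsets of
  \<open>T\<close> is trivial. Counting boundaries as powers of 2 thus replaces dimension
  theory.\<close>

lemma inj_on_bd:
  assumes "acyclic_family T" "finite T"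
  shows "inj_on bd (Pow T)"
proof (rule inj_onI)
  fix X Y assume XY: "X \<in> Pow T" "Y \<in> Pow T" "bd X = bd Y"
  then have "finite X" "finite Y" using assms(2) by (auto intro: finite_subset)
  then have "bd (sym_diff X Y) = {}" using XY(3) by (simp add: bd_sym_diff)
  moreover have "sym_diff X Y \<subseteq> T" using XY by blast
  ultimately have "sym_diff X Y = {}" using assms(1) unfolding acyclic_family_def by blast
  then show "X = Y" by blast
qed

lemma card_bd_image:
  "acyclic_family T \<Longrightarrow> finite T \<Longrightarrow> card (bd ` Pow T) = 2 ^ card T"
  by (simp add: card_image inj_on_bd card_Pow)

text \<open>The full star of a vertex \<open>v\<close> is a hypertree: the cone over \<open>antistar v Z\<close> fills the cycle \<open>Z\<close>.\<close>

lemma card_boundaries: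
  assumes "finite V" "v \<in> V"
  shows "card (bd ` Pow (faces V (Suc k))) = 2 ^ ((card V - 1) choose k)"
proof -
  let ?G = "faces (V - {v}) k"
  let ?S = "cone v ?G"
  have nv: "\<forall>g\<in>?G. v \<notin> g" by (rule faces_avoid) blast
  have finS: "finite ?S" using assms(1) by (simp add: finite_faces)
  have SF: "?S \<subseteq> faces V (Suc k)" using assms by (intro cone_faces) auto
  have acyc: "acyclic_family ?S"
    unfolding acyclic_family_def
  proof (intro allI impI)
    fix Y assume Y: "Y \<subseteq> ?S" "bd Y = {}"
    have "finite Y" using Y(1) finS by (rule finite_subset)
    \<comment> \<open>Every member of the star contains \<open>v\<close>, so a cycle there has an
      empty antistar and hence an empty link.\<close>
    moreover have A: "antistar v Y = {}" using Y(1) by (auto simp: antistar_def)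
    ultimately have "link v Y = {}" using cycle_antistar_link(1)[of Y v] Y(2) by simp
    then show "Y = {}" using A decompose[of Y v] by simp
  qed
  have "bd X \<in> bd ` Pow ?S" if X: "X \<subseteq> faces V (Suc k)" for X
  proof -
    let ?B = "antistar v (bd X)"
    have "finite X" using X finite_faces[OF assms(1)] by (rule finite_subset)
    moreover have f: "\<forall>s\<in>X. finite s"
      using X assms(1) by (metis (mono_tags, lifting) faces_def finite_subset mem_Collect_eq subsetD)
    ultimately have cyc: "finite (bd X)" "bd (bd X) = {}" by (simp_all add: finite_bd bd_bd)
    have "bd (cone v ?B) = sym_diff ?B (cone v (bd ?B))"
      by (rule bd_cone) (simp add: antistar_def)
    also have "\<dots> = sym_diff ?B (cone v (link v (bd X)))"
      using cycle_antistar_link(1)[OF cyc, of v] by simp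
    also have "\<dots> = bd X" by (rule decompose[symmetric])
    finally have "bd (cone v ?B) = bd X" .
    moreover have "cone v ?B \<subseteq> ?S" using antistar_faces[OF bd_faces[OF X], of v] by (rule image_mono)
    ultimately show ?thesis by (metis PowI image_eqI)
  qed
  then have "bd ` Pow (faces V (Suc k)) \<subseteq> bd ` Pow ?S"
    by (intro image_subsetI) (simp only: Pow_iff)
  moreover have "bd ` Pow ?S \<subseteq> bd ` Pow (faces V (Suc k))"
    using SF by (intro image_mono Pow_mono)
  ultimately have "bd ` Pow (faces V (Suc k)) = bd ` Pow ?S" by (rule equalityI)
  also have "card \<dots> = 2 ^ card ?S" by (rule card_bd_image[OF acyc finS])
  also have "card ?S = (card V - 1) choose k"
    using assms by (simp add: card_image[OF inj_cone[OF nv]] card_faces)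
  finally show ?thesis .
qed

lemma card_acyclic_le:
  assumes "finite V" "v \<in> V" "F \<subseteq> faces V (Suc k)" "acyclic_family F"
  shows "card F \<le> (card V - 1) choose k"
proof -
  have "finite F" using assms(3) finite_faces[OF assms(1)] by (rule finite_subset)
  then have "2 ^ card F = card (bd ` Pow F)" using assms(4) by (simp add: card_bd_image)
  also have "\<dots> \<le> card (bd ` Pow (faces V (Suc k)))"
    using assms(1,3) by (intro card_mono image_mono) (auto simp: finite_faces)
  also have "\<dots> = 2 ^ ((card V - 1) choose k)" by (rule card_boundaries[OF assms(1,2)])
  finally show ?thesis by simp
qed

text \<open>Maximality puts the boundary of each simplex among the boundaries from \<open>T\<close>;
  by linearity these are then all boundaries, and counting them determines
  \<open>card T\<close>.\<close>

lemma card_maximal_acyclic: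
  assumes "finite V" "v \<in> V" "T \<subseteq> faces V (Suc k)" "acyclic_family T"
    and max: "\<And>s. s \<in> faces V (Suc k) \<Longrightarrow> acyclic_family (insert s T) \<Longrightarrow> s \<in> T"
  shows "card T = (card V - 1) choose k"
proof -
  have finT: "finite T" using assms(3) finite_faces[OF assms(1)] by (rule finite_subset)
  have one: "\<exists>Y \<subseteq> T. bd Y = bd {s}" if s: "s \<in> faces V (Suc k)" for s
  proof (cases "s \<in> T")
    case False
    then obtain Y where Y: "Y \<subseteq> insert s T" "bd Y = {}" "Y \<noteq> {}"
      using max[OF s] unfolding acyclic_family_def by blast
    \<comment> \<open>The cycle must use \<open>s\<close> because \<open>T\<close> is acyclic;
      removing \<open>s\<close> leaves a filling of \<open>bd {s}\<close> inside
      \<open>T\<close>.\<close>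
    have "s \<in> Y" using Y assms(4) unfolding acyclic_family_def by blast
    then have "Y = insert s (Y - {s})" by blast
    moreover have "finite (Y - {s})" using Y(1) finT by (meson finite_Diff finite_insert finite_subset)
    ultimately have "sym_diff (bd {s}) (bd (Y - {s})) = {}"
      using bd_insert[of "Y - {s}" s] Y(2) by simp
    then have "bd (Y - {s}) = bd {s}" by blast
    moreover have "Y - {s} \<subseteq> T" using Y(1) by blast
    ultimately show ?thesis by (intro exI conjI)
  qed (auto intro!: exI[of _ "{s}"])
  have "\<exists>Y \<subseteq> T. bd Y = bd X" if "finite X" "X \<subseteq> faces V (Suc k)" for X
    using that
  proof (induction X rule: finite_induct)
    case (insert s X)
    obtain Y where Y: "Y \<subseteq> T" "bd Y = bd X" using insert by auto
    obtain Y' where Y': "Y' \<subseteq> T" "bd Y' = bd {s}" using one insert.prems by (metis insert_subset)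
    have "finite Y" "finite Y'" using Y(1) Y'(1) finT by (blast intro: finite_subset)+
    then have "bd (sym_diff Y' Y) = bd (insert s X)"
      using bd_insert[OF insert.hyps] Y(2) Y'(2) by (simp add: bd_sym_diff)
    moreover have "sym_diff Y' Y \<subseteq> T" using Y(1) Y'(1) by blast
    ultimately show ?case by (intro exI conjI)
  qed (auto intro!: exI[of _ "{}"])
  then have "\<exists>Y \<subseteq> T. bd Y = bd X" if "X \<subseteq> faces V (Suc k)" for X
    using that finite_subset[OF that finite_faces[OF assms(1)]] by simp
  then have "bd ` Pow (faces V (Suc k)) \<subseteq> bd ` Pow T"
    by (intro image_subsetI) (metis PowD PowI image_eqI)
  moreover have "bd ` Pow T \<subseteq> bd ` Pow (faces V (Suc k))"
    using assms(3) by (intro image_mono Pow_mono)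
  ultimately have "bd ` Pow T = bd ` Pow (faces V (Suc k))" by (intro equalityI)
  then have "2 ^ card T = (2::nat) ^ ((card V - 1) choose k)"
    using card_bd_image[OF assms(4) finT] card_boundaries[OF assms(1,2), of k] by simp
  then show ?thesis by simp
qed

subsection \<open>Boundaries of hypertrees\<close>

lemma simplices_eq_faces: "simplices n d = faces {1..n} (Suc d)"
  by (simp add: simplices_def faces_def)

text \<open>In a family of simplices of one size, containing a face with one vertex fewer means
  extending it by a single vertex.\<close>

lemma boundary_eq_bd:
  assumes "X \<subseteq> simplices n d"
  shows "boundary n d X = bd X"
proof -
  have X: "X \<subseteq> faces {1..n} (Suc d)" using assms by (simp add: simplices_eq_faces)
  have "t \<in> boundary n d X \<longleftrightarrow> t \<in> bd X" if t: "t \<in> faces {1..n} d" for t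
  proof -
    have "t \<subseteq> s \<longleftrightarrow> (\<exists>x. x \<notin> t \<and> s = insert x t)" if "s \<in> X" for s
    proof
      assume "t \<subseteq> s"
      moreover have s: "card s = Suc d" "card t = d" "finite s"
        using that X t finite_subset[of s "{1..n}"] by (auto simp: faces_def)
      ultimately have "card (s - t) = 1" by (simp add: card_Diff_subset finite_subset)
      then obtain x where "s - t = {x}" by (auto simp: card_1_singleton_iff)
      then show "\<exists>x. x \<notin> t \<and> s = insert x t" using \<open>t \<subseteq> s\<close> by blast
    qed auto
    then have "{s \<in> X. t \<subseteq> s} = {s \<in> X. \<exists>x. x \<notin> t \<and> s = insert x t}" by blast
    then show ?thesis using t unfolding boundary_def bd_def faces_def by simp
  qed
  moreover have "boundary n d X \<subseteq> faces {1..n} d" by (auto simp: boundary_def faces_def)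
  ultimately show ?thesis using bd_faces[OF X] by blast
qed

lemma is_forest_iff: "is_forest n d F \<longleftrightarrow> F \<subseteq> simplices n d \<and> acyclic_family F"
proof -
  have "is_cycle n d Y \<longleftrightarrow> bd Y = {}" if "F \<subseteq> simplices n d" "Y \<subseteq> F" for Y
    using that boundary_eq_bd[of Y n d] by (simp add: is_cycle_def subset_trans)
  then show ?thesis unfolding is_forest_def acyclic_family_def by blast
qed

text \<open>Maximality becomes a count: maximal forests all attain the rank of the boundary
  operator, and no forest exceeds it. A filling of the right size is therefore a hypertree.\<close>

lemma is_hypertree_iff:
  assumes "n \<ge> 1"
  shows "is_hypertree n d T \<longleftrightarrow>
    T \<subseteq> simplices n d \<and> acyclic_family T \<and> card T = (n - 1) choose d"
proof
  assume H: "is_hypertree n d T"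
  then have T: "T \<subseteq> simplices n d" "acyclic_family T"
    by (simp_all add: is_hypertree_def is_forest_iff)
  have "s \<in> T" if "s \<in> faces {1..n} (Suc d)" "acyclic_family (insert s T)" for s
  proof -
    have "is_forest n d (insert s T)" using that T by (simp add: is_forest_iff simplices_eq_faces)
    then have "insert s T = T" using H unfolding is_hypertree_def by blast
    then show ?thesis by blast
  qed
  then have "card T = (card {1..n} - 1) choose d"
    using T assms by (intro card_maximal_acyclic[of _ 1]) (auto simp: simplices_eq_faces)
  then show "T \<subseteq> simplices n d \<and> acyclic_family T \<and> card T = (n - 1) choose d" using T by simp
next
  assume T: "T \<subseteq> simplices n d \<and> acyclic_family T \<and> card T = (n - 1) choose d"
  have "F = T" if F: "is_forest n d F" "T \<subseteq> F" for F
  proof -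
    have F': "F \<subseteq> faces {1..n} (Suc d)" "acyclic_family F"
      using F(1) by (simp_all add: is_forest_iff simplices_eq_faces)
    have "card F \<le> (card {1..n} - 1) choose d"
      using assms F' by (intro card_acyclic_le[of _ 1]) auto
    moreover have "finite F" using F'(1) finite_faces[of "{1..n}"] by (meson finite_atLeastAtMost finite_subset)
    ultimately show ?thesis using T F(2) card_seteq[of F T] by simp
  qed
  then show "is_hypertree n d T" using T by (simp add: is_hypertree_def is_forest_iff)
qed

theorem theorem1:
  fixes n :: nat and Z :: "nat set set"
  assumes "n \<ge> 1"
    and "is_cycle n 1 Z" and "Z \<noteq> {}"
  shows "(\<exists>T. is_hypertree n 2 T \<and> boundary n 2 T = Z) \<longleftrightarrow>
         [card Z = (n - 1) choose 2] (mod 2)"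
proof -
  have parity: "[card Z = (n - 1) choose 2] (mod 2) \<longleftrightarrow> (even (card Z) \<longleftrightarrow> even ((n - 1) choose 2))"
    unfolding cong_def by (metis even_iff_mod_2_eq_zero not_mod_2_eq_0_eq_1)
  have s3: "simplices n 2 = faces {1..n} 3" by (simp add: simplices_eq_faces)
  have Z: "Z \<subseteq> faces {1..n} 2" "bd Z = {}"
    using assms(2) boundary_eq_bd[of Z n 1]
    by (simp_all add: is_cycle_def simplices_eq_faces numeral_2_eq_2)
  show ?thesis unfolding parity
  proof
    assume "\<exists>T. is_hypertree n 2 T \<and> boundary n 2 T = Z"
    then obtain T where "is_hypertree n 2 T" and bdT: "boundary n 2 T = Z" by blast
    then have T: "T \<subseteq> faces {1..n} 3" "card T = (n - 1) choose 2"
      by (simp_all add: is_hypertree_iff[OF assms(1)] s3)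
    have "finite T" using T(1) by (rule finite_subset) (simp add: finite_faces)
    then have "odd (card (bd T)) \<longleftrightarrow> odd (card T)" using T(1) by (intro odd_card_bd) auto
    moreover have "bd T = Z" using bdT boundary_eq_bd[of T n 2] T(1) s3 by simp
    ultimately show "even (card Z) \<longleftrightarrow> even ((n - 1) choose 2)" using T(2) by simp
  next
    assume "even (card Z) \<longleftrightarrow> even ((n - 1) choose 2)"
    then obtain T where T: "T \<subseteq> faces {1..n} 3" "acyclic_family T"
        "card T = (n - 1) choose 2" "bd T = Z"
      using exists_acyclic_filling[of "{1..n}" "n - 1" Z] Z assms(1,3) by auto
    then have "is_hypertree n 2 T" "boundary n 2 T = Z"
      using boundary_eq_bd[of T n 2] by (simp_all add: is_hypertree_iff[OF assms(1)] s3)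
    then show "\<exists>T. is_hypertree n 2 T \<and> boundary n 2 T = Z" by blast
  qed
qed

end
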